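(* For every integer $n\ge 1$ and every $x\in\mathbb{R}$, \[ \sin(n\operatorname{arccot} x) = \frac{(-1)^{n-1}\, q_{n-1}(x)}{(1+x^2)^{n/2}}. \]
   Context: For each integer $n\ge 0$, the polynomial $q_n:\mathbb{R}\to\mathbb{R}$ is defined by \[ q_n(x) = (-1)^n \sum_{k\ \text{even},\ 0\le k\le n} \binom{n+1}{k+1} (-1)^{k/2} x^{n-k}, \] with the convention $x^0=1$ for all $x$. The function $\operatorname{arccot}(x)=\frac{\pi}{2}-\arctan(x)$ is the inverse function of the cotangent restricted to $(0,\pi)$. *)

theory Defs
  imports Complex_Main
begin

text \<open>The power \<open>x ^ 0\<close> is \<open>1\<close> for every \<open>x\<close>, including \<open>x = 0\<close>; \<open>k div 2\<close> is exact on the even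
  indices \<open>k\<close> of the sum.\<close>

definition q :: "nat \<Rightarrow> real \<Rightarrow> real" where
  "q n x = (- 1) ^ n *
     (\<Sum>k | even k \<and> k \<le> n. real ((n + 1) choose (k + 1)) * (- 1) ^ (k div 2) * x ^ (n - k))"

definition arccot :: "real \<Rightarrow> real" where
  "arccot x = pi / 2 - arctan x"

text \<open>\<open>arccot\<close> is the inverse of the cotangent restricted to the open interval from \<open>0\<close> to \<open>pi\<close>.\<close>

lemma arccot_bounds: "0 < arccot x" "arccot x < pi"
  using arctan_lbound[of x] arctan_ubound[of x] by (simp_all add: arccot_def)

lemma cot_arccot: "cot (arccot x) = x"
proof -
  have "cot (arccot x) = tan (arctan x)"
    by (simp add: arccot_def cot_def tan_def sin_diff cos_diff)
  then show ?thesis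
    by (simp add: tan_arctan)
qed

lemma arccot_cot: "0 < y \<Longrightarrow> y < pi \<Longrightarrow> arccot (cot y) = y"
proof -
  assume y: "0 < y" "y < pi"
  have "cot y = tan (pi / 2 - y)"
    by (simp add: cot_def tan_def sin_diff cos_diff)
  moreover have "arctan (tan (pi / 2 - y)) = pi / 2 - y"
    using y by (intro arctan_tan) auto
  ultimately show ?thesis
    by (simp add: arccot_def)
qed

end

theory Submission
  imports Defs
begin

text \<open>Since \<open>x + \<i>\<close> has modulus \<open>sqrt (1 + x\<^sup>2)\<close> and argument \<open>arccot x\<close>, De Moivre's formula
  turns the sine into the imaginary part of \<open>(x + \<i>) ^ n\<close>, which the binomial theorem expands:
  only the odd powers of \<open>\<i>\<close> contribute.\<close>

text \<open>Source of both the restriction to even \<open>k\<close> and the sign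
  \<open>(- 1) ^ (k div 2)\<close> in \<open>q\<close>.\<close>

lemma Re_imaginary_unit_power: "Re (\<i> ^ k) = (if even k then (- 1) ^ (k div 2) else 0)"
proof (cases "even k")
  case True
  then obtain j where "k = 2 * j" ..
  moreover have "Re ((- 1) ^ j) = (- 1) ^ j"
    by (induction j) auto
  ultimately show ?thesis
    by (simp add: power_mult)
next
  case False
  then obtain j where "k = 2 * j + 1" ..
  moreover have "Im ((- 1) ^ j) = 0"
    by (induction j) auto
  ultimately show ?thesis
    by (simp add: power_mult)
qed

lemma Im_power_eq_q: "Im ((complex_of_real x + \<i>) ^ Suc m) = (- 1) ^ m * q m x"
proof -
  have "Im ((complex_of_real x + \<i>) ^ Suc m) =
      (\<Sum>k\<le>Suc m. real (Suc m choose k) * Im (\<i> ^ k) * x ^ (Suc m - k))"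
    \<comment> \<open>In \<open>binomial_ring\<close> the first summand carries the exponent
      \<open>k\<close>, so \<open>\<i>\<close> is moved to the front.\<close>
    unfolding add.commute[of _ \<i>] binomial_ring Im_sum
    by (rule sum.cong) (simp_all flip: of_real_power del: binomial_Suc_Suc)
  \<comment> \<open>The term for \<open>k = 0\<close> vanishes since \<open>Im 1 = 0\<close>; after
    the shift, \<open>Im (\<i> * z) = Re z\<close> applies.\<close>
  also have "\<dots> = (\<Sum>k\<le>m. real (Suc m choose Suc k) * Re (\<i> ^ k) * x ^ (m - k))"
    by (subst sum.atMost_Suc_shift) simp
  also have "\<dots> = (\<Sum>k | even k \<and> k \<le> m.
      real ((m + 1) choose (k + 1)) * (- 1) ^ (k div 2) * x ^ (m - k))"
    by (rule sum.mono_neutral_cong_right) (auto simp: Re_imaginary_unit_power)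
  \<comment> \<open>The sign inside \<open>q\<close> cancels, as \<open>(- 1) ^ m\<close> squares to
    1.\<close>
  also have "\<dots> = (- 1) ^ m * q m x"
    by (simp add: q_def)
  finally show ?thesis .
qed

lemma rcis_arccot: "rcis (sqrt (1 + x\<^sup>2)) (arccot x) = complex_of_real x + \<i>"
proof -
  \<comment> \<open>Allows cancelling the denominators in \<open>sin_arctan\<close> and
    \<open>cos_arctan\<close>.\<close>
  have "sqrt (1 + x\<^sup>2) \<noteq> 0"
    by (simp add: add_nonneg_eq_0_iff)
  then show ?thesis
    by (simp add: complex_eq_iff arccot_def sin_diff cos_diff sin_arctan cos_arctan)
qed

theorem theorem6p1:
  fixes n :: nat and x :: real
  assumes "n \<ge> 1"
  shows "sin (real n * arccot x) = (- 1) ^ (n - 1) * q (n - 1) x / (1 + x\<^sup>2) powr (real n / 2)"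
proof -
  have pos: "0 < 1 + x\<^sup>2"
    by (simp add: add_pos_nonneg)
  have "(1 + x\<^sup>2) powr (real n / 2) = sqrt (1 + x\<^sup>2) powr real n"
    using pos by (simp add: powr_powr flip: powr_half_sqrt)
  also have "\<dots> = sqrt (1 + x\<^sup>2) ^ n"
    using pos by (simp add: powr_realpow)
  finally have modulus: "(1 + x\<^sup>2) powr (real n / 2) = sqrt (1 + x\<^sup>2) ^ n" .
  have "sqrt (1 + x\<^sup>2) ^ n * sin (real n * arccot x) = Im ((complex_of_real x + \<i>) ^ n)"
    by (simp add: DeMoivre2 flip: rcis_arccot)
  \<comment> \<open>Here \<open>n \<ge> 1\<close> enters, giving
    \<open>Suc (n - 1) = n\<close>.\<close>
  also have "\<dots> = (- 1) ^ (n - 1) * q (n - 1) x"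
    using Im_power_eq_q[of x "n - 1"] assms by simp
  finally show ?thesis
    using pos by (simp add: modulus field_simps)
qed

end
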